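(* For every integer $n\geq 0$, we have $|A_{2n+1}(1243)|=|A_{2n+1}(2143)|$.
   Context: A permutation $\pi=\pi_1\pi_2\cdots\pi_m$ of $[m]=\{1,2,\ldots,m\}$ is alternating if $\pi_1<\pi_2>\pi_3<\pi_4>\cdots$. A permutation $\pi$ contains a pattern $\sigma=\sigma_1\cdots\sigma_k\in S_k$ if there are indices $i_1<i_2<\cdots<i_k$ such that $\pi_{i_1}\pi_{i_2}\cdots\pi_{i_k}$ is order isomorphic to $\sigma$, i.e. $\pi_{i_l}<\pi_{i_r}$ if and only if $\sigma_l<\sigma_r$ for all $l,r\in[k]$; otherwise $\pi$ avoids $\sigma$. $A_m(\sigma)$ denotes the set of alternating permutations of $[m]$ that avoid $\sigma$. *)

theory Defs
  imports "HOL-Combinatorics.Multiset_Permutations"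
begin

text \<open>
  Permutations of \<open>{1..m}\<close> are written in one-line notation, as the lists in
  \<^term>\<open>permutations_of_set {1..m}\<close>. List positions are counted from 0, so the entry
  \<open>\<pi>\<^sub>i\<close> is \<open>p ! (i - 1)\<close>, and the ascents of an alternating permutation start at the
  even list positions.
\<close>

definition alternating :: "nat list \<Rightarrow> bool" where
  "alternating p \<longleftrightarrow>
    (\<forall>i. Suc i < length p \<longrightarrow> (if even i then p ! i < p ! Suc i else p ! i > p ! Suc i))"

definition contains_pattern :: "nat list \<Rightarrow> nat list \<Rightarrow> bool" where
  "contains_pattern p s \<longleftrightarrow>
    (\<exists>f :: nat \<Rightarrow> nat. strict_mono_on {..<length s} f \<and> f ` {..<length s} \<subseteq> {..<length p} \<and>
      (\<forall>l<length s. \<forall>r<length s. p ! f l < p ! f r \<longleftrightarrow> s ! l < s ! r))"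

definition alternating_avoiders :: "nat \<Rightarrow> nat list \<Rightarrow> nat list set" where
  "alternating_avoiders m s =
    {p \<in> permutations_of_set {1..m}. alternating p \<and> \<not> contains_pattern p s}"

end

theory Submission
  imports Defs
begin

text \<open>
  Both patterns end in a descent lying above and to the right of their first two entries. Fix a
  permutation, seen as a set of cells (position, value), and shade every cell that has a descent
  above and to its right. The shaded region is closed under moving down or left, so it is a Young
  diagram. Call an entry low if its cell is shaded. The permutation contains 1243 if and only if
  two low entries form an ascent, and it contains 2143 if and only if two low entries form a
  descent whose upper right corner is shaded.

  The key point is that the low entries may be redistributed inside the shaded region without
  changing it: the region is determined by the entries that are not low
  (\<open>shaded_obtain_nonlow_witness\<close>, \<open>redistribute_shaded\<close>). So permutations are grouped by their
  skeleton, what is left after erasing the low entries. The theorem holds because each group of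
  alternating permutations contains at most one 1243-avoider and at most one 2143-avoider, and
  contains one of them if and only if it contains the other.

  Uniqueness: two permutations with the same skeleton are compared at the last position where
  they differ, and this position produces the pattern in one of them (\<open>last_difference\<close>).

  Existence: swapping the two low entries of an occurrence keeps the skeleton and changes the
  sum of position times value in a known direction, so the extremal permutations of a group are
  avoiders. Alternation survives because in an alternating avoider of either pattern the low
  entries are all valleys, whose neighbours are peaks that are not low; a peak that is not low
  exceeds every value that can be moved next to it within the shaded region
  (\<open>redistribute_alternating\<close>).
\<close>

section \<open>The shaded region and the two patterns\<close>

definition shaded :: "nat list \<Rightarrow> (nat \<times> nat) set" where
  "shaded p = {(i, v). \<exists>j k. i < j \<and> j < k \<and> k < length p \<and> v < p ! k \<and> p ! k < p ! j}"

definition low :: "nat list \<Rightarrow> nat \<Rightarrow> bool" where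
  "low p i \<longleftrightarrow> (i, p ! i) \<in> shaded p"

lemma shadedI:
  "i < j \<Longrightarrow> j < k \<Longrightarrow> k < length p \<Longrightarrow> v < p ! k \<Longrightarrow> p ! k < p ! j \<Longrightarrow> (i, v) \<in> shaded p"
  unfolding shaded_def by blast

lemma shaded_down_left: "(i, v) \<in> shaded p \<Longrightarrow> i' \<le> i \<Longrightarrow> v' \<le> v \<Longrightarrow> (i', v') \<in> shaded p"
  unfolding shaded_def by (auto intro: le_less_trans)

lemma shaded_less_length: "(i, v) \<in> shaded p \<Longrightarrow> i < length p"
  unfolding shaded_def by auto

lemma contains_pattern_4:
  assumes "length s = 4"
  shows "contains_pattern p s \<longleftrightarrow>
    (\<exists>a b c d. a < b \<and> b < c \<and> c < d \<and> d < length p \<and>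
      (\<forall>l \<in> {0, 1, 2, 3}. \<forall>r \<in> {0, 1, 2, 3}.
        p ! ([a, b, c, d] ! l) < p ! ([a, b, c, d] ! r) \<longleftrightarrow> s ! l < s ! r))"
    (is "?L \<longleftrightarrow> ?R")
proof -
  have four: "{..<length s} = {0, 1, 2, 3}"
    using assms by auto
  have contains: "contains_pattern p s \<longleftrightarrow>
    (\<exists>f. strict_mono_on {0, 1, 2, 3} f \<and> f ` {0, 1, 2, 3} \<subseteq> {..<length p} \<and>
      (\<forall>l \<in> {0, 1, 2, 3}. \<forall>r \<in> {0, 1, 2, 3}. p ! f l < p ! f r \<longleftrightarrow> s ! l < s ! r))"
    unfolding contains_pattern_def four[symmetric] by (simp only: Ball_def lessThan_iff)
  show ?thesis
  proof
    assume ?L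
    then obtain f where mono: "strict_mono_on {0, 1, 2, 3} f" and
      range: "f ` {0, 1, 2, 3} \<subseteq> {..<length p}" and
      order: "\<forall>l \<in> {0, 1, 2, 3}. \<forall>r \<in> {0, 1, 2, 3}. p ! f l < p ! f r \<longleftrightarrow> s ! l < s ! r"
      unfolding contains by blast
    have "f 0 < f 1 \<and> f 1 < f 2 \<and> f 2 < f 3 \<and> f 3 < length p"
      using mono range by (auto simp: strict_mono_on_def)
    moreover have "[f 0, f 1, f 2, f 3] ! l = f l" if "l \<in> {0, 1, 2, 3}" for l
      using that by auto
    ultimately show ?R
      using order by (intro exI[of _ "f 0"] exI[of _ "f 1"] exI[of _ "f 2"] exI[of _ "f 3"]) simp
  next
    assume ?R
    then obtain a b c d where pos: "a < b" "b < c" "c < d" "d < length p" and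
      order: "\<forall>l \<in> {0, 1, 2, 3}. \<forall>r \<in> {0, 1, 2, 3}.
        p ! ([a, b, c, d] ! l) < p ! ([a, b, c, d] ! r) \<longleftrightarrow> s ! l < s ! r"
      by blast
    have "strict_mono_on {0, 1, 2, 3} ((!) [a, b, c, d])"
      using pos by (auto simp: strict_mono_on_def)
    moreover have "(!) [a, b, c, d] ` {0, 1, 2, 3} \<subseteq> {..<length p}"
      using pos by auto
    ultimately show ?L
      using order unfolding contains by blast
  qed
qed

lemma contains_1243:
  "contains_pattern p [1, 2, 4, 3] \<longleftrightarrow> (\<exists>a b. a < b \<and> p ! a < p ! b \<and> low p b)"
proof -
  have "contains_pattern p [1, 2, 4, 3] \<longleftrightarrow>
    (\<exists>a b c d. a < b \<and> b < c \<and> c < d \<and> d < length p \<and>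
      p ! a < p ! b \<and> p ! b < p ! d \<and> p ! d < p ! c)"
    by (subst contains_pattern_4, simp) (intro ex_cong1, auto)
  then show ?thesis
    unfolding low_def shaded_def by blast
qed

lemma contains_2143:
  "contains_pattern p [2, 1, 4, 3] \<longleftrightarrow> (\<exists>a b. a < b \<and> p ! b < p ! a \<and> (b, p ! a) \<in> shaded p)"
proof -
  have "contains_pattern p [2, 1, 4, 3] \<longleftrightarrow>
    (\<exists>a b c d. a < b \<and> b < c \<and> c < d \<and> d < length p \<and>
      p ! b < p ! a \<and> p ! a < p ! d \<and> p ! d < p ! c)"
    by (subst contains_pattern_4, simp) (intro ex_cong1, auto)
  then show ?thesis
    unfolding shaded_def by blast
qed

section \<open>The skeleton determines the shaded region\<close>

text \<open>
  If one of the two entries of a descent is low, then a descent above and to the right of that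
  entry serves as well, and it starts further to the right. The rightmost choice is
  free of low entries.
\<close>

lemma shaded_obtain_nonlow_witness:
  assumes "(i, v) \<in> shaded p"
  obtains j k where "i < j" "j < k" "k < length p" "v < p ! k" "p ! k < p ! j"
    "\<not> low p j" "\<not> low p k"
proof -
  have "(i, v) \<in> shaded p \<Longrightarrow> \<exists>j k. i < j \<and> j < k \<and> k < length p \<and> v < p ! k \<and> p ! k < p ! j \<and>
    \<not> low p j \<and> \<not> low p k"
  proof (induction "length p - i" arbitrary: i v rule: less_induct)
    case less
    then obtain j k where jk: "i < j" "j < k" "k < length p" "v < p ! k" "p ! k < p ! j"
      unfolding shaded_def by auto
    show ?case
    proof (cases "low p j \<or> low p k")
      case True
      then obtain x where x: "x \<in> {j, k}" "(x, p ! x) \<in> shaded p"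
        unfolding low_def by auto
      have "length p - x < length p - i" "i < x" "v < p ! x"
        using x(1) jk by auto
      then show ?thesis
        using less.hyps[OF _ x(2)] by (meson less_trans)
    qed (use jk in blast)
  qed
  with assms that show ?thesis
    by blast
qed

definition skeleton :: "nat list \<Rightarrow> nat option list" where
  "skeleton p = map (\<lambda>i. if low p i then None else Some (p ! i)) [0..<length p]"

lemma length_skeleton [simp]: "length (skeleton p) = length p"
  unfolding skeleton_def by simp

lemma nth_skeleton:
  "i < length p \<Longrightarrow> skeleton p ! i = (if low p i then None else Some (p ! i))"
  unfolding skeleton_def by simp

lemma skeleton_eq_iff:
  "skeleton p = skeleton q \<longleftrightarrow> length p = length q \<and>
    (\<forall>i<length p. (low p i \<longleftrightarrow> low q i) \<and> (\<not> low p i \<longrightarrow> p ! i = q ! i))"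
proof -
  have "skeleton p ! i = skeleton q ! i \<longleftrightarrow>
      (low p i \<longleftrightarrow> low q i) \<and> (\<not> low p i \<longrightarrow> p ! i = q ! i)"
    if "i < length p" "length p = length q" for i
    using that nth_skeleton[of i p] nth_skeleton[of i q] by simp
  then show ?thesis
    unfolding list_eq_iff_nth_eq[of "skeleton p"] length_skeleton by blast
qed

lemma shaded_subset_if_agree_nonlow:
  assumes "length q = length p" and "\<And>i. i < length p \<Longrightarrow> \<not> low p i \<Longrightarrow> q ! i = p ! i"
  shows "shaded p \<subseteq> shaded q"
proof (rule subrelI)
  fix i v assume "(i, v) \<in> shaded p"
  then obtain j k where "i < j" "j < k" "k < length p" "v < p ! k" "p ! k < p ! j"
    "\<not> low p j" "\<not> low p k"
    by (rule shaded_obtain_nonlow_witness)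
  then show "(i, v) \<in> shaded q"
    using assms by (intro shadedI[of i j k]) auto
qed

lemma shaded_eq_if_skeleton_eq:
  assumes "skeleton p = skeleton q"
  shows "shaded p = shaded q"
  using assms shaded_subset_if_agree_nonlow[of p q] shaded_subset_if_agree_nonlow[of q p]
  unfolding skeleton_eq_iff by auto

section \<open>Uniqueness: each skeleton has at most one avoider\<close>

text \<open>
  The low entries of two such permutations fill the same positions with the same values. So at
  the last difference \<open>b\<close>, the entry that \<open>q\<close> has there occurs in \<open>p\<close> too, at an earlier
  position.
\<close>

lemma last_difference:
  assumes p: "p \<in> permutations_of_set A" and q: "q \<in> permutations_of_set A"
    and skel: "skeleton p = skeleton q"
    and b: "b < length p" "p ! b \<noteq> q ! b" and after: "\<And>i. b < i \<Longrightarrow> i < length p \<Longrightarrow> p ! i = q ! i"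
  shows "\<exists>a<b. p ! a = q ! b" and "(b, q ! b) \<in> shaded p"
proof -
  have len: "length q = length p"
    using skel unfolding skeleton_eq_iff by simp
  have "low q b"
    using skel b unfolding skeleton_eq_iff by auto
  then show "(b, q ! b) \<in> shaded p"
    unfolding low_def shaded_eq_if_skeleton_eq[OF skel] .
  have "q ! b \<in> set p"
    using p q b len permutations_of_setD(1) nth_mem by metis
  then obtain a where a: "a < length p" "p ! a = q ! b"
    by (auto simp: in_set_conv_nth)
  have "\<not> b < a"
  proof
    assume "b < a"
    then have "q ! a = q ! b"
      using a after by auto
    then show False
      using a b len \<open>b < a\<close> permutations_of_setD(2)[OF q] by (auto simp: nth_eq_iff_index_eq)
  qed
  then show "\<exists>a<b. p ! a = q ! b"
    using a b by (metis nat_neq_iff)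
qed

text \<open>
  At the last difference \<open>b\<close>, the permutation with the larger entry has the smaller one earlier,
  which gives 1243; the permutation with the smaller entry has the larger one earlier, which
  gives 2143.
\<close>

lemma skeleton_eq_imp_contains:
  assumes p: "p \<in> permutations_of_set A" and q: "q \<in> permutations_of_set A"
    and skel: "skeleton p = skeleton q" and "p \<noteq> q"
  shows "contains_pattern p [1, 2, 4, 3] \<or> contains_pattern q [1, 2, 4, 3]"
    and "contains_pattern p [2, 1, 4, 3] \<or> contains_pattern q [2, 1, 4, 3]"
proof -
  have len: "length q = length p"
    using skel unfolding skeleton_eq_iff by simp
  define D where "D = {i. i < length p \<and> p ! i \<noteq> q ! i}"
  have "finite D" "D \<noteq> {}"
    using \<open>p \<noteq> q\<close> len unfolding D_def by (auto simp: list_eq_iff_nth_eq)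
  define b where "b = Max D"
  have b: "b < length p" "p ! b \<noteq> q ! b"
    using Max_in[OF \<open>finite D\<close> \<open>D \<noteq> {}\<close>] unfolding b_def D_def by auto
  have after: "p ! i = q ! i" if "b < i" "i < length p" for i
  proof -
    have "i \<notin> D"
      using Max_ge[OF \<open>finite D\<close>, of i] that(1) unfolding b_def by auto
    then show ?thesis
      using that(2) unfolding D_def by simp
  qed
  obtain a where a: "a < b" "p ! a = q ! b"
    using last_difference(1)[OF p q skel b after] by auto
  obtain a' where a': "a' < b" "q ! a' = p ! b"
    using last_difference(1)[OF q p skel[symmetric], of b] b after len by auto
  have "(b, q ! b) \<in> shaded p" "(b, p ! b) \<in> shaded q"
    using last_difference(2)[OF p q skel b after]
      last_difference(2)[OF q p skel[symmetric], of b] b after len by auto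
  then have shaded: "(b, x) \<in> shaded r" if "x \<in> {p ! b, q ! b}" "r \<in> {p, q}" for x r
    using that shaded_eq_if_skeleton_eq[OF skel] by auto
  show "contains_pattern p [1, 2, 4, 3] \<or> contains_pattern q [1, 2, 4, 3]"
    unfolding contains_1243 low_def using a a' b shaded by (metis insertCI linorder_neqE_nat)
  show "contains_pattern p [2, 1, 4, 3] \<or> contains_pattern q [2, 1, 4, 3]"
    unfolding contains_2143 using a a' b shaded by (metis insertCI linorder_neqE_nat)
qed

section \<open>Redistributing the low entries\<close>

locale redistribution =
  fixes p q :: "nat list"
  assumes same_length: "length q = length p"
    and nonlow: "\<And>i. i < length p \<Longrightarrow> \<not> low p i \<Longrightarrow> q ! i = p ! i"
    and stays_shaded: "\<And>i. low p i \<Longrightarrow> (i, q ! i) \<in> shaded p"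
begin

text \<open>
  No new cell gets shaded: a cell below and to the left of a moved entry was shaded before,
  because the moved entry itself stays inside the shaded region of \<open>p\<close>.
\<close>

lemma redistribute_shaded: "shaded q = shaded p"
proof
  show "shaded p \<subseteq> shaded q"
    by (rule shaded_subset_if_agree_nonlow) (use same_length nonlow in auto)
  show "shaded q \<subseteq> shaded p"
  proof (rule subrelI)
    fix i v assume "(i, v) \<in> shaded q"
    then obtain j k where jk: "i < j" "j < k" "k < length p" "v < q ! k" "q ! k < q ! j"
      unfolding shaded_def same_length by auto
    show "(i, v) \<in> shaded p"
    proof (cases "low p j \<or> low p k")
      case True
      then obtain x where x: "x \<in> {j, k}" "low p x"
        by auto
      then have "i \<le> x" "v \<le> q ! x"
        using jk by auto
      with stays_shaded[OF x(2)] show ?thesis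
        by (rule shaded_down_left)
    next
      case False
      then show ?thesis
        using jk nonlow by (intro shadedI[of i j k]) auto
    qed
  qed
qed

lemma redistribute_skeleton: "skeleton q = skeleton p"
  using same_length nonlow stays_shaded
  unfolding skeleton_eq_iff low_def redistribute_shaded by metis

text \<open>
  Let a value \<open>v\<close> be moved to a valley at position \<open>i\<close>. If \<open>v\<close> were at least the neighbouring
  peak, then a descent above and to the right of \<open>(i, v)\<close> would lie above and to the right of this
  peak as well, and the peak would be low. For the right neighbour this uses that the descent
  cannot start at the peak itself, which is too small.
\<close>

lemma redistribute_alternating:
  assumes alt: "alternating p" and even_low: "\<And>i. low p i \<Longrightarrow> even i"
  shows "alternating q"
  unfolding alternating_def same_length
proof (intro allI impI)
  fix i assume i: "Suc i < length p"
  show "if even i then q ! i < q ! Suc i else q ! Suc i < q ! i"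
  proof (cases "even i")
    case True
    have peak: "\<not> low p (Suc i)" "q ! Suc i = p ! Suc i"
      using even_low[of "Suc i"] nonlow[of "Suc i"] True i by auto
    show ?thesis
    proof (cases "low p i")
      case low: True
      have "q ! i < p ! Suc i"
      proof (rule ccontr)
        assume "\<not> q ! i < p ! Suc i"
        moreover obtain j k where "i < j" "j < k" "k < length p" "q ! i < p ! k" "p ! k < p ! j"
          using stays_shaded[OF low] unfolding shaded_def by auto
        moreover from calculation have "j \<noteq> Suc i"
          by auto
        ultimately have "low p (Suc i)"
          unfolding low_def by (intro shadedI[of _ j k]) auto
        with peak show False by blast
      qed
      with True peak show ?thesis by simp
    next
      case False
      with True peak i nonlow[of i] alt show ?thesis
        unfolding alternating_def by auto
    qed
  next
    case False
    have peak: "\<not> low p i" "q ! i = p ! i"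
      using even_low[of i] nonlow[of i] False i by auto
    show ?thesis
    proof (cases "low p (Suc i)")
      case True
      have "q ! Suc i < p ! i"
        using shaded_down_left[OF stays_shaded[OF True], of i "p ! i"] peak
        unfolding low_def by linarith
      with False peak show ?thesis by simp
    next
      case nonlow_valley: False
      with False peak i nonlow[of "Suc i"] alt show ?thesis
        unfolding alternating_def by auto
    qed
  qed
qed

end

section \<open>Existence: extremal rearrangements avoid the patterns\<close>

definition swap :: "nat list \<Rightarrow> nat \<Rightarrow> nat \<Rightarrow> nat list" where
  "swap p a b = p[a := p ! b, b := p ! a]"

lemma length_swap [simp]: "length (swap p a b) = length p"
  unfolding swap_def by simp

lemma nth_swap:
  "a < length p \<Longrightarrow> b < length p \<Longrightarrow>
    swap p a b ! i = (if i = b then p ! a else if i = a then p ! b else p ! i)"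
  unfolding swap_def by (auto simp: nth_list_update)

lemma swap_permutations_of_set:
  assumes "p \<in> permutations_of_set A" "a < length p" "b < length p"
  shows "swap p a b \<in> permutations_of_set A"
  using assms unfolding swap_def permutations_of_set_def by simp

lemma redistribution_swap:
  assumes "a < b" "(b, p ! a) \<in> shaded p" "(b, p ! b) \<in> shaded p"
  shows "redistribution p (swap p a b)"
proof -
  have "b < length p"
    using shaded_less_length[OF assms(2)] .
  moreover have "(a, p ! a) \<in> shaded p" "(a, p ! b) \<in> shaded p"
    using assms by (auto intro: shaded_down_left)
  ultimately show ?thesis
    using assms by unfold_locales (auto simp: nth_swap low_def)
qed

definition weight :: "nat list \<Rightarrow> nat" where
  "weight p = (\<Sum>i<length p. i * p ! i)"

lemma weight_swap:
  assumes "a < b" "b < length p"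
  shows "weight (swap p a b) + (a * p ! a + b * p ! b) = weight p + (a * p ! b + b * p ! a)"
proof -
  have split: "(\<Sum>i<length p. f i) = f a + (f b + (\<Sum>i\<in>{..<length p} - {a} - {b}. f i))"
    for f :: "nat \<Rightarrow> nat"
    using assms by (simp add: sum.remove[of _ a] sum.remove[of _ b])
  have "(\<Sum>i\<in>{..<length p} - {a} - {b}. i * swap p a b ! i) =
      (\<Sum>i\<in>{..<length p} - {a} - {b}. i * p ! i)"
    using assms by (intro sum.cong) (auto simp: nth_swap)
  then show ?thesis
    using assms unfolding weight_def length_swap split by (simp add: nth_swap)
qed

lemma rearrangement_strict:
  fixes a b x y :: nat
  assumes "a < b" "x < y"
  shows "a * y + b * x < a * x + b * y"
proof -
  obtain c d where "b = a + Suc c" "y = x + Suc d"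
    using assms by (metis less_iff_Suc_add add_Suc_right)
  then show ?thesis
    by (simp add: algebra_simps)
qed

lemma weight_swap_descent:
  assumes "a < b" "b < length p" "p ! b < p ! a"
  shows "weight p < weight (swap p a b)"
  using weight_swap[OF assms(1,2)] rearrangement_strict[OF assms(1,3)] by linarith

lemma weight_swap_ascent:
  assumes "a < b" "b < length p" "p ! a < p ! b"
  shows "weight (swap p a b) < weight p"
  using weight_swap[OF assms(1,2)] rearrangement_strict[OF assms(1,3)] by linarith

definition skeleton_class :: "nat set \<Rightarrow> nat list \<Rightarrow> nat list set" where
  "skeleton_class A p = {q \<in> permutations_of_set A. alternating q \<and> skeleton q = skeleton p}"

lemma finite_skeleton_class: "finite (skeleton_class A p)"
  unfolding skeleton_class_def by simp

lemma low_skeleton_eq: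
  assumes "skeleton q = skeleton p"
  shows "low q i \<longleftrightarrow> low p i"
  using assms shaded_less_length unfolding skeleton_eq_iff low_def by metis

lemma swap_in_skeleton_class:
  assumes even_low: "\<And>i. low p i \<Longrightarrow> even i" and q: "q \<in> skeleton_class A p"
    and ab: "a < b" "(b, q ! a) \<in> shaded q" "(b, q ! b) \<in> shaded q"
  shows "swap q a b \<in> skeleton_class A p"
proof -
  interpret redistribution q "swap q a b"
    using ab by (rule redistribution_swap)
  have q: "q \<in> permutations_of_set A" "alternating q" "skeleton q = skeleton p"
    using q unfolding skeleton_class_def by auto
  have "b < length q"
    using shaded_less_length[OF ab(2)] .
  then show ?thesis
    using ab q even_low swap_permutations_of_set[of q A a b]
      redistribute_skeleton redistribute_alternating low_skeleton_eq[OF q(3)]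
    unfolding skeleton_class_def by auto
qed

text \<open>
  Swapping the ends of a low ascent lowers the weight, and swapping the ends of a descent with
  shaded upper right corner raises it. So a 1243-avoider is found at the minimum of the weight and
  a 2143-avoider at the maximum.
\<close>

lemma skeleton_class_avoiders:
  assumes even_low: "\<And>i. low p i \<Longrightarrow> even i"
    and p: "p \<in> permutations_of_set A" "alternating p"
  shows "\<exists>q \<in> skeleton_class A p. \<not> contains_pattern q [1, 2, 4, 3]"
    and "\<exists>q \<in> skeleton_class A p. \<not> contains_pattern q [2, 1, 4, 3]"
proof -
  note swap_in = swap_in_skeleton_class[OF even_low]
  have ne: "skeleton_class A p \<noteq> {}"
    using p unfolding skeleton_class_def by auto
  obtain q where q: "q \<in> skeleton_class A p" "weight q = Min (weight ` skeleton_class A p)"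
    using Min_in[OF finite_imageI[OF finite_skeleton_class], of weight A p] ne
    by (metis imageE image_is_empty)
  have min: "weight q \<le> weight r" if "r \<in> skeleton_class A p" for r
    using that q(2) finite_skeleton_class by simp
  have "\<not> contains_pattern q [1, 2, 4, 3]"
  proof
    assume "contains_pattern q [1, 2, 4, 3]"
    then obtain a b where ab: "a < b" "q ! a < q ! b" "(b, q ! b) \<in> shaded q"
      unfolding contains_1243 low_def by auto
    then have "(b, q ! a) \<in> shaded q"
      by (auto intro: shaded_down_left)
    with ab min[OF swap_in[OF _ q(1) ab(1)]]
      weight_swap_ascent[OF ab(1) shaded_less_length[OF ab(3)] ab(2)]
    show False by auto
  qed
  with q(1) show "\<exists>q \<in> skeleton_class A p. \<not> contains_pattern q [1, 2, 4, 3]" by blast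
  obtain q where q: "q \<in> skeleton_class A p" "weight q = Max (weight ` skeleton_class A p)"
    using Max_in[OF finite_imageI[OF finite_skeleton_class], of weight A p] ne
    by (metis imageE image_is_empty)
  have max: "weight r \<le> weight q" if "r \<in> skeleton_class A p" for r
    using that q(2) finite_skeleton_class by simp
  have "\<not> contains_pattern q [2, 1, 4, 3]"
  proof
    assume "contains_pattern q [2, 1, 4, 3]"
    then obtain a b where ab: "a < b" "q ! b < q ! a" "(b, q ! a) \<in> shaded q"
      unfolding contains_2143 by auto
    then have "(b, q ! b) \<in> shaded q"
      by (auto intro: shaded_down_left)
    with ab max[OF swap_in[OF _ q(1) ab(1)]]
      weight_swap_descent[OF ab(1) shaded_less_length[OF ab(3)] ab(2)]
    show False by auto
  qed
  with q(1) show "\<exists>q \<in> skeleton_class A p. \<not> contains_pattern q [2, 1, 4, 3]" by blast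
qed

section \<open>Low entries of alternating avoiders are valleys\<close>

text \<open>A low peak and the valley before it would be the first two entries of a 1243.\<close>

lemma even_low_if_avoids_1243:
  assumes "alternating p" "\<not> contains_pattern p [1, 2, 4, 3]" "low p i"
  shows "even i"
proof (rule ccontr)
  assume "odd i"
  then obtain h where h: "i = Suc h" "even h"
    by (cases i) auto
  have "i < length p"
    using assms(3) shaded_less_length unfolding low_def by blast
  then have "p ! h < p ! i"
    using assms(1) h unfolding alternating_def by simp
  then show False
    using assms(2,3) h(1) lessI unfolding contains_1243 by blast
qed

text \<open>
  A low peak and the valley after it would be the first two entries of a 2143: a descent above
  the peak cannot start at that valley, so it lies to the right of both.
\<close>

lemma even_low_if_avoids_2143:
  assumes "alternating p" "\<not> contains_pattern p [2, 1, 4, 3]" "low p i"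
  shows "even i"
proof (rule ccontr)
  assume "odd i"
  obtain j k where jk: "i < j" "j < k" "k < length p" "p ! i < p ! k" "p ! k < p ! j"
    using assms(3) unfolding low_def shaded_def by auto
  have descent: "p ! Suc i < p ! i"
    using assms(1) \<open>odd i\<close> jk unfolding alternating_def by simp
  with jk have "j \<noteq> Suc i"
    by auto
  with jk have "(Suc i, p ! i) \<in> shaded p"
    by (intro shadedI[of _ j k]) auto
  then show False
    using assms(2) descent lessI unfolding contains_2143 by blast
qed

section \<open>Comparing the two classes of avoiders\<close>

lemma inj_on_skeleton:
  assumes "s \<in> {[1, 2, 4, 3], [2, 1, 4, 3]}"
  shows "inj_on skeleton (alternating_avoiders m s)"
proof (rule inj_onI, rule ccontr)
  fix p q
  assume p: "p \<in> alternating_avoiders m s" and q: "q \<in> alternating_avoiders m s"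
    and skel: "skeleton p = skeleton q" and "p \<noteq> q"
  have "p \<in> permutations_of_set {1..m}" "q \<in> permutations_of_set {1..m}"
    using p q unfolding alternating_avoiders_def by simp_all
  then have "contains_pattern p s \<or> contains_pattern q s"
    using assms skeleton_eq_imp_contains[OF _ _ skel \<open>p \<noteq> q\<close>] by blast
  then show False
    using p q unfolding alternating_avoiders_def by simp
qed

lemma skeleton_mem_image:
  assumes "q \<in> skeleton_class {1..m} p" "\<not> contains_pattern q s"
  shows "skeleton p \<in> skeleton ` alternating_avoiders m s"
proof
  show "skeleton p = skeleton q" "q \<in> alternating_avoiders m s"
    using assms unfolding skeleton_class_def alternating_avoiders_def by simp_all
qed

lemma skeleton_image_eq:
  "skeleton ` alternating_avoiders m [1, 2, 4, 3] = skeleton ` alternating_avoiders m [2, 1, 4, 3]"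
proof (intro equalityI image_subsetI)
  fix p assume "p \<in> alternating_avoiders m [1, 2, 4, 3]"
  then have p: "p \<in> permutations_of_set {1..m}" "alternating p"
    "\<not> contains_pattern p [1, 2, 4, 3]"
    unfolding alternating_avoiders_def by auto
  obtain q where "q \<in> skeleton_class {1..m} p" "\<not> contains_pattern q [2, 1, 4, 3]"
    using skeleton_class_avoiders(2)[OF even_low_if_avoids_1243[OF p(2,3)] p(1,2)] by blast
  then show "skeleton p \<in> skeleton ` alternating_avoiders m [2, 1, 4, 3]"
    by (rule skeleton_mem_image)
next
  fix p assume "p \<in> alternating_avoiders m [2, 1, 4, 3]"
  then have p: "p \<in> permutations_of_set {1..m}" "alternating p"
    "\<not> contains_pattern p [2, 1, 4, 3]"
    unfolding alternating_avoiders_def by auto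
  obtain q where "q \<in> skeleton_class {1..m} p" "\<not> contains_pattern q [1, 2, 4, 3]"
    using skeleton_class_avoiders(1)[OF even_low_if_avoids_2143[OF p(2,3)] p(1,2)] by blast
  then show "skeleton p \<in> skeleton ` alternating_avoiders m [1, 2, 4, 3]"
    by (rule skeleton_mem_image)
qed

theorem theorem2p1:
  fixes n :: nat
  shows "card (alternating_avoiders (2 * n + 1) [1, 2, 4, 3]) =
         card (alternating_avoiders (2 * n + 1) [2, 1, 4, 3])"
proof -
  have "card (alternating_avoiders (2 * n + 1) s) =
      card (skeleton ` alternating_avoiders (2 * n + 1) s)"
    if "s \<in> {[1, 2, 4, 3], [2, 1, 4, 3]}" for s
    using card_image[OF inj_on_skeleton[OF that]] by simp
  then show ?thesis
    by (simp only: skeleton_image_eq insertI1 insertI2)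
qed

end
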